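(* Let $T$ be a threshold choosing function satisfying both $1$-Goodness and Monotonicity. Fix a property $P\subseteq[n]$ and a target size $k$, and let $A_1,\dots,A_m$ be streams, $U=\bigcup_j A_j$ the set of their distinct identifiers, and $A^*=A_1\circ A_2\circ\cdots\circ A_m$ their concatenation. Let $(\theta^*,S^* )=\mathrm{samp}[T](k,A^*,h)$ and $\hat n^{A^*}_{P,A^*}=|P(S^* )|/\theta^*$. Let $(\theta_j,S_j)=\mathrm{samp}[T](k,A_j,h)$, $(\theta^U,S^U)=\mathrm{ThetaUnion}(\{(\theta_j,S_j)\})$, and $\hat n^U_{P,U}=|P(S^U)|/\theta^U$. Then, with randomness over the perfectly random hash function $h$, $$\sigma^2(\hat n^U_{P,U})\le\sigma^2(\hat n^{A^*}_{P,A^*}).$$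
   Context: Identifiers come from $[n]$. A stream is a finite sequence of identifiers; $n_A$ is the number of distinct identifiers of $A$. The hash function $h:[n]\to(0,1)$ is perfectly random (the $h(x)$ are i.i.d. Uniform$(0,1)$). A threshold choosing function (TCF) $T$ maps target size $k$, stream $A$ and $h$ to $\theta\in(0,1]$, depending on $h$ only through the hash values $X^{n_A}$ of the distinct identifiers of $A$. $\mathrm{samp}[T](k,A,h)$ returns $(\theta,S)$ with $\theta=T(k,A,h)$ and $S$ the set of hash values of identifiers of $A$ that are $<\theta$ (identifiers retained); $P(S)$ is the subset of hash values in $S$ whose identifiers lie in $P$. $\mathrm{ThetaUnion}$ of sketches $(\theta_j,S_j)$ returns $(\theta_U,S_U)$ with $\theta_U=\min_j\theta_j$, $S_U=\{x\in\bigcup_j S_j: x<\theta_U\}$. A function $f:(0,1)\to(0,1]$ satisfies $1$-Goodness if there is $F$ with $x<F\Rightarrow f(x)=F$ and $x\ge F\Rightarrow f(x)\le x$. $T$ satisfies $1$-Goodness if for every stream $A$, every distinct identifier $\ell$ of $A$ and every fixed assignment of hash values to the other distinct identifiers of $A$, the map $x_\ell\mapsto T$ (evaluated with $\ell$ hashed to $x_\ell$) satisfies $1$-Goodness. $T$ satisfies Monotonicity if for any three streams $A_0,A_1,A_2$, any $h$ and $k$, $T(k,A_0\circ A_1\circ A_2,h)\le T(k,A_1,h)$.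
   Formalization: In 1-Goodness the fixed threshold F is required to lie in (0,1]; allowing F ≤ 0 makes the claim false (T = 1/2 for one identifier, half the minimum hash for more). T is also assumed measurable in h, with k ≥ 1 and m ≥ 1. *)

theory Defs
  imports "HOL-Probability.Probability"
begin

text \<open>Identifiers are the elements of \<open>{1..n}\<close>. A hash function is an extensional function on
  identifiers with values in the open unit interval.\<close>

type_synonym hash = "nat \<Rightarrow> real"
type_synonym stream = "nat list"
type_synonym sketch = "real \<times> real set"
type_synonym tcf = "nat \<Rightarrow> stream \<Rightarrow> hash \<Rightarrow> real"

definition streams_over :: "nat \<Rightarrow> stream set" where
  "streams_over n = lists {1..n}"

definition hashes :: "nat \<Rightarrow> hash set" where
  "hashes n = {1..n} \<rightarrow>\<^sub>E {0<..<1}"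

text \<open>The uniform distribution on \<open>(0,1)\<close> is taken on the space \<open>(0,1)\<close> itself, so that
  the sample space of the product is exactly \<open>hashes n\<close>.\<close>

definition uniform01 :: "real measure" where
  "uniform01 = restrict_space lborel {0<..<1}"

definition random_hash :: "nat \<Rightarrow> hash measure" where
  "random_hash n = (\<Pi>\<^sub>M i\<in>{1..n}. uniform01)"

lemma prob_space_uniform01: "prob_space uniform01"
  by (rule prob_spaceI) (simp add: uniform01_def emeasure_restrict_space space_restrict_space)

lemma prob_space_random_hash: "prob_space (random_hash n)"
  unfolding random_hash_def by (intro prob_space_PiM prob_space_uniform01)

lemma space_random_hash: "space (random_hash n) = hashes n"
  by (simp add: random_hash_def hashes_def space_PiM uniform01_def space_restrict_space)

text \<open>The target size ranges over the positive integers.\<close>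

definition threshold_choosing :: "nat \<Rightarrow> tcf \<Rightarrow> bool" where
  "threshold_choosing n T \<longleftrightarrow>
     (\<forall>k\<ge>1. \<forall>A\<in>streams_over n. \<forall>h\<in>hashes n. 0 < T k A h \<and> T k A h \<le> 1) \<and>
     (\<forall>k\<ge>1. \<forall>A\<in>streams_over n. \<forall>h\<in>hashes n. \<forall>h'\<in>hashes n.
        (\<forall>i\<in>set A. h i = h' i) \<longrightarrow> T k A h = T k A h')"

text \<open>The fixed threshold \<open>F\<close> is required to lie in \<open>(0,1]\<close>, like every threshold. Allowing
  \<open>F = 0\<close> would admit functions with \<open>f x \<le> x\<close> everywhere, for which no identifier is ever
  retained and the estimator is not unbiased.\<close>

definition one_good_fun :: "(real \<Rightarrow> real) \<Rightarrow> bool" where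
  "one_good_fun f \<longleftrightarrow>
     (\<exists>F\<in>{0<..1}. \<forall>x\<in>{0<..<1}. (x < F \<longrightarrow> f x = F) \<and> (F \<le> x \<longrightarrow> f x \<le> x))"

definition one_goodness :: "nat \<Rightarrow> tcf \<Rightarrow> bool" where
  "one_goodness n T \<longleftrightarrow>
     (\<forall>k\<ge>1. \<forall>A\<in>streams_over n. \<forall>l\<in>set A. \<forall>h\<in>hashes n. one_good_fun (\<lambda>x. T k A (h(l := x))))"

definition monotonicity :: "nat \<Rightarrow> tcf \<Rightarrow> bool" where
  "monotonicity n T \<longleftrightarrow>
     (\<forall>A0\<in>streams_over n. \<forall>A1\<in>streams_over n. \<forall>A2\<in>streams_over n. \<forall>h\<in>hashes n. \<forall>k\<ge>1.
        T k (A0 @ A1 @ A2) h \<le> T k A1 h)"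

definition samp :: "tcf \<Rightarrow> nat \<Rightarrow> stream \<Rightarrow> hash \<Rightarrow> sketch" where
  "samp T k A h = (let \<theta> = T k A h in (\<theta>, {x \<in> h ` set A. x < \<theta>}))"

definition theta_union :: "sketch set \<Rightarrow> sketch" where
  "theta_union K = (let \<theta> = Min (fst ` K) in (\<theta>, {x \<in> \<Union>(snd ` K). x < \<theta>}))"

definition with_property :: "nat set \<Rightarrow> hash \<Rightarrow> real set \<Rightarrow> real set" where
  "with_property P h S = {x \<in> S. \<exists>i\<in>P. h i = x}"

definition estimate :: "nat set \<Rightarrow> hash \<Rightarrow> sketch \<Rightarrow> real" where
  "estimate P h s = real (card (with_property P h (snd s))) / fst s"

text \<open>The second moment of an estimator may be infinite, whereas the Bochner integral of a
  non-integrable function is \<open>0\<close>. The variance is therefore taken with values in \<open>[0,\<infinity>]\<close>; the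
  next lemma says that it is the usual one for square-integrable random variables.\<close>

definition evariance :: "'a measure \<Rightarrow> ('a \<Rightarrow> real) \<Rightarrow> ennreal" where
  "evariance M X = (\<integral>\<^sup>+ \<omega>. ennreal ((X \<omega> - integral\<^sup>L M X)\<^sup>2) \<partial>M)"

lemma evariance_eq_variance:
  assumes "prob_space M" "X \<in> borel_measurable M" "integrable M (\<lambda>\<omega>. (X \<omega>)\<^sup>2)"
  shows "evariance M X = ennreal (prob_space.variance M X)"
proof -
  interpret prob_space M by fact
  have "integrable M X"
    using assms(2,3) by (rule square_integrable_imp_integrable)
  with assms(3) have "integrable M (\<lambda>\<omega>. (X \<omega> - expectation X)\<^sup>2)"
    by (simp add: power2_diff)
  then show ?thesis
    unfolding evariance_def by (intro nn_integral_eq_integral) auto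
qed

end

theory Submission
  imports Defs
begin

text \<open>Almost surely the hash values are distinct, so both estimators are sums over \<open>P \<inter> U\<close> of
  the weights \<open>1/\<tau>\<close> of the retained identifiers, where \<open>\<tau>\<close> is \<open>\<theta>\<^sup>*\<close> or \<open>\<theta>\<^sup>U\<close>; by Monotonicity
  \<open>\<theta>\<^sup>* \<le> \<theta>\<^sup>U\<close>, and \<open>\<theta>\<^sup>U\<close> inherits 1-Goodness as a minimum. Conditioned on the other hash
  values, a weight is \<open>1/F\<close> with probability \<open>F\<close>. Its mean is therefore \<open>1\<close>, and its second moment
  \<open>1/F\<close> decreases in \<open>F\<close>, so it is smaller for \<open>\<theta>\<^sup>U\<close>.

  The mixed moments may increase from \<open>\<theta>\<^sup>*\<close> to \<open>\<theta>\<^sup>U\<close>. With the other hash values fixed, the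
  region where two given identifiers are both retained is either a square \<open>(0,c)\<^sup>2\<close> on which
  the threshold is \<open>c\<close>, contributing \<open>1\<close>, or empty, contributing \<open>0\<close>. So every mixed moment is at
  most \<open>1\<close>. If the region is empty, then \<open>F y \<le> y\<close> for the threshold seen by the first identifier
  when the second hashes to \<open>y\<close>, and the conditional second moment \<open>\<integral> 1/F y dy\<close> is infinite. Hence
  either the right-hand variance is infinite, or its mixed moments all equal \<open>1\<close>.\<close>

section \<open>Functions of one hash value that satisfy 1-Goodness\<close>

text \<open>Below \<open>F\<close> the value is \<open>F\<close>, hence above \<open>x\<close>; from
  \<open>F\<close> on it is at most \<open>x\<close>. So the retention event \<open>x < f x\<close>
  is cut out by the fixed bound \<open>F\<close>.\<close>

lemma one_good_funE:
  assumes "one_good_fun f"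
  obtains F where "0 < F" "F \<le> 1"
    and "\<And>x. x \<in> {0<..<1} \<Longrightarrow> x < f x \<longleftrightarrow> x < F"
    and "\<And>x. x \<in> {0<..<1} \<Longrightarrow> x < F \<Longrightarrow> f x = F"
proof -
  from assms obtain F where F: "F \<in> {0<..1}"
    and *: "\<And>x. x \<in> {0<..<1} \<Longrightarrow> (x < F \<longrightarrow> f x = F) \<and> (F \<le> x \<longrightarrow> f x \<le> x)"
    unfolding one_good_fun_def by blast
  have "x < f x \<longleftrightarrow> x < F" if "x \<in> {0<..<1}" for x
    using *[OF that] by (cases "x < F") auto
  with F * show thesis by (intro that) auto
qed

lemma one_good_fun_cong:
  assumes "\<And>x. x \<in> {0<..<1} \<Longrightarrow> f x = g x"
  shows "one_good_fun f \<longleftrightarrow> one_good_fun g"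
  using assms unfolding one_good_fun_def by simp

text \<open>Serves identifiers absent from a stream, whose hash value does not affect the threshold;
  \<open>c\<close> itself is the bound.\<close>

lemma one_good_fun_const: "c \<in> {0<..1} \<Longrightarrow> one_good_fun (\<lambda>_. c)"
  unfolding one_good_fun_def by (intro bexI[of _ c]) auto

text \<open>The bound of the minimum is \<open>min F G\<close>: below it both functions take their
  own bounds as values, and from it on at least one of them is at most \<open>x\<close>.\<close>

lemma one_good_fun_min:
  assumes "one_good_fun f" "one_good_fun g"
  shows "one_good_fun (\<lambda>x. min (f x) (g x))"
proof -
  obtain F where F: "F \<in> {0<..1}"
    "\<And>x. x \<in> {0<..<1} \<Longrightarrow> (x < F \<longrightarrow> f x = F) \<and> (F \<le> x \<longrightarrow> f x \<le> x)"
    using assms(1) unfolding one_good_fun_def by blast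
  obtain G where G: "G \<in> {0<..1}"
    "\<And>x. x \<in> {0<..<1} \<Longrightarrow> (x < G \<longrightarrow> g x = G) \<and> (G \<le> x \<longrightarrow> g x \<le> x)"
    using assms(2) unfolding one_good_fun_def by blast
  show ?thesis
    unfolding one_good_fun_def
  proof (intro bexI[of _ "min F G"] ballI)
    fix x :: real assume "x \<in> {0<..<1}"
    from F(2)[OF this] G(2)[OF this]
    show "(x < min F G \<longrightarrow> min (f x) (g x) = min F G) \<and> (min F G \<le> x \<longrightarrow> min (f x) (g x) \<le> x)"
      by (auto simp: min_def split: if_splits)
  qed (use F G in \<open>auto simp: min_def\<close>)
qed

lemma one_good_fun_Min:
  assumes "finite I" "I \<noteq> {}" "\<And>i. i \<in> I \<Longrightarrow> one_good_fun (f i)"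
  shows "one_good_fun (\<lambda>x. Min ((\<lambda>i. f i x) ` I))"
  using assms
proof (induction I rule: finite_ne_induct)
  case (insert i I)
  then have "one_good_fun (\<lambda>x. min (f i x) (Min ((\<lambda>i. f i x) ` I)))"
    by (intro one_good_fun_min) auto
  with insert show ?case by simp
qed simp

section \<open>Integrals against the uniform distribution\<close>

lemma space_uniform01: "space uniform01 = {0<..<1}"
  by (simp add: uniform01_def space_restrict_space)

lemma measurable_uniform01_borel [measurable]: "(\<lambda>x. x) \<in> borel_measurable uniform01"
  unfolding uniform01_def by (intro measurable_restrict_space1) simp

lemma nn_integral_uniform01:
  "(\<integral>\<^sup>+x. f x \<partial>uniform01) = (\<integral>\<^sup>+x. f x * indicator {0<..<1} x \<partial>lborel)"
  unfolding uniform01_def by (subst nn_integral_restrict_space) auto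

lemma nn_integral_uniform01_less:
  fixes F :: real
  assumes "0 < F" "F \<le> 1"
  shows "(\<integral>\<^sup>+x. (if x < F then c else 0) \<partial>uniform01) = c * ennreal F"
proof -
  have "(\<integral>\<^sup>+x. (if x < F then c else 0) \<partial>uniform01) = (\<integral>\<^sup>+x. c * indicator {0<..<F} x \<partial>lborel)"
    unfolding nn_integral_uniform01
    using assms by (intro nn_integral_cong) (auto simp: indicator_def)
  also have "\<dots> = c * ennreal F"
    using assms by (simp add: nn_integral_cmult)
  finally show ?thesis .
qed

text \<open>Logarithmic divergence at 0. It forces an infinite second moment when two identifiers
  are never retained together.\<close>

lemma nn_integral_uniform01_inverse: "(\<integral>\<^sup>+x. ennreal (1 / x) \<partial>uniform01) = \<infinity>"
proof -
  have le: "ennreal (real N) \<le> (\<integral>\<^sup>+x. ennreal (1 / x) \<partial>uniform01)" for N :: nat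
  proof -
    \<comment> \<open>Chosen so that the integral of \<open>1 / x\<close> from
      \<open>\<delta>\<close> to 1 is exactly \<open>N\<close>.\<close>
    define \<delta> where "\<delta> = exp (- real N)"
    have \<delta>: "0 < \<delta>" "\<delta> \<le> 1" by (auto simp: \<delta>_def)
    have "ennreal (real N) = ennreal (ln 1 - ln \<delta>)"
      by (simp add: \<delta>_def)
    also have "\<dots> = (\<integral>\<^sup>+x. ennreal (1 / x) * indicator {\<delta>..1} x \<partial>lborel)"
      using \<delta> by (intro nn_integral_FTC_Icc[symmetric])
        (auto intro!: derivative_eq_intros simp flip: has_real_derivative_iff_has_vector_derivative)
    also have "\<dots> \<le> (\<integral>\<^sup>+x. ennreal (1 / x) * indicator {0<..<1} x \<partial>lborel)"
    \<comment> \<open>The closed interval leaves \<open>{0<..<1}\<close> only at the endpoint 1, a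
      null set.\<close>
    proof (rule nn_integral_mono_AE)
      have "AE x in lborel. x \<noteq> (1::real)"
        by (rule AE_lborel_singleton)
      then show "AE x in lborel. ennreal (1 / x) * indicator {\<delta>..1} x
                   \<le> ennreal (1 / x) * indicator {0<..<1} x"
        by eventually_elim (use \<delta> in \<open>auto simp: indicator_def\<close>)
    qed
    finally show ?thesis
      by (simp add: nn_integral_uniform01)
  qed
  show ?thesis
  proof (rule ccontr)
    assume "\<not> ?thesis"
    then obtain r where "(\<integral>\<^sup>+x. ennreal (1 / x) \<partial>uniform01) = ennreal r" "0 \<le> r"
      by (cases "\<integral>\<^sup>+x. ennreal (1 / x) \<partial>uniform01") auto
    with le show False
      by (metis ennreal_le_iff linorder_not_le reals_Archimedean2)
  qed
qed

section \<open>Redrawing single hash values\<close>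

lemma hashes_fun_upd: "h \<in> hashes n \<Longrightarrow> i \<in> {1..n} \<Longrightarrow> x \<in> {0<..<1} \<Longrightarrow> h(i := x) \<in> hashes n"
  by (auto simp: hashes_def PiE_def extensional_def)

lemma measurable_random_hash_component:
  assumes "i \<in> {1..n}"
  shows "(\<lambda>h. h i) \<in> borel_measurable (random_hash n)"
proof -
  have "(\<lambda>h. h i) \<in> measurable (random_hash n) uniform01"
    unfolding random_hash_def using assms by (rule measurable_component_singleton)
  from measurable_compose[OF this measurable_uniform01_borel] show ?thesis .
qed

lemma borel_measurable_random_hash_resample:
  fixes f :: "hash \<Rightarrow> ennreal"
  assumes i: "i \<in> {1..n}" and f: "f \<in> borel_measurable (random_hash n)"
  shows "(\<lambda>h. \<integral>\<^sup>+x. f (h(i := x)) \<partial>uniform01) \<in> borel_measurable (random_hash n)"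
proof -
  interpret prob_space uniform01 by (rule prob_space_uniform01)
  have upd: "(\<lambda>(h, x). h(i := x)) \<in> measurable (random_hash n \<Otimes>\<^sub>M uniform01) (random_hash n)"
    unfolding random_hash_def case_prod_beta
    by (rule measurable_fun_upd[where J = "{1..n}"]) (use i in auto)
  show ?thesis
    using measurable_compose[OF upd f]
    by (intro borel_measurable_nn_integral) (simp add: case_prod_beta')
qed

text \<open>Takes the place of conditioning on the other hash values: by independence, redrawing one
  coordinate from its own law leaves the joint law unchanged.\<close>

lemma nn_integral_random_hash_resample:
  assumes i: "i \<in> {1..n}" and f: "f \<in> borel_measurable (random_hash n)"
  shows "(\<integral>\<^sup>+h. f h \<partial>random_hash n) = (\<integral>\<^sup>+h. \<integral>\<^sup>+x. f (h(i := x)) \<partial>uniform01 \<partial>random_hash n)"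
proof -
  interpret U: prob_space uniform01 by (rule prob_space_uniform01)
  interpret product_sigma_finite "\<lambda>_. uniform01"
    by unfold_locales
  define I where "I = {1..n} - {i}"
  have I: "finite I" "i \<notin> I" "{1..n} = insert i I"
    using i by (auto simp: I_def)
  note g = borel_measurable_random_hash_resample[OF assms]
  have "(\<integral>\<^sup>+h. \<integral>\<^sup>+x. f (h(i := x)) \<partial>uniform01 \<partial>random_hash n)
      = (\<integral>\<^sup>+h. \<integral>\<^sup>+y. \<integral>\<^sup>+x. f (h(i := y, i := x)) \<partial>uniform01 \<partial>uniform01 \<partial>Pi\<^sub>M I (\<lambda>_. uniform01))"
    using g unfolding random_hash_def I(3)
    by (subst product_nn_integral_insert[OF I(1,2)]) auto
  \<comment> \<open>The update by \<open>x\<close> overwrites \<open>y\<close>, so the integral over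
    \<open>y\<close> is that of a constant against a probability measure.\<close>
  also have "\<dots> = (\<integral>\<^sup>+h. \<integral>\<^sup>+x. f (h(i := x)) \<partial>uniform01 \<partial>Pi\<^sub>M I (\<lambda>_. uniform01))"
    by (simp add: U.emeasure_space_1)
  also have "\<dots> = (\<integral>\<^sup>+h. f h \<partial>random_hash n)"
    using f unfolding random_hash_def I(3)
    by (subst product_nn_integral_insert[OF I(1,2)]) auto
  finally show ?thesis ..
qed

lemma AE_random_hash_inj: "AE h in random_hash n. inj_on h {1..n}"
proof -
  have "AE h in random_hash n. h i \<noteq> h j" if ij: "i \<in> {1..n}" "j \<in> {1..n}" "i \<noteq> j" for i j
  proof -
    note [measurable] = ij(1,2)[THEN measurable_random_hash_component]
    have "(\<integral>\<^sup>+h. indicator {h \<in> space (random_hash n). h i = h j} h \<partial>random_hash n)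
        = (\<integral>\<^sup>+h. \<integral>\<^sup>+x. indicator {h \<in> space (random_hash n). h i = h j} (h(i := x))
             \<partial>uniform01 \<partial>random_hash n)"
      by (rule nn_integral_random_hash_resample[OF ij(1)]) measurable
    \<comment> \<open>With the other values fixed, a collision means that \<open>x\<close> hits the
      single point \<open>h j\<close>, which the update leaves alone because
      \<open>i \<noteq> j\<close>.\<close>
    also have "\<dots> \<le> (\<integral>\<^sup>+h. \<integral>\<^sup>+x. indicator {h j} x \<partial>lborel \<partial>random_hash n)"
      unfolding nn_integral_uniform01 using ij(3)
      by (intro nn_integral_mono) (auto simp: indicator_def)
    also have "\<dots> = 0"
      by simp
    finally have "emeasure (random_hash n) {h \<in> space (random_hash n). h i = h j} = 0"
      by (subst (asm) nn_integral_indicator) auto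
    then show ?thesis
      by (subst AE_iff_measurable[OF _ refl]) auto
  qed
  then have "AE h in random_hash n. \<forall>i\<in>{1..n}. \<forall>j\<in>{1..n}. i \<noteq> j \<longrightarrow> h i \<noteq> h j"
    by (intro AE_finite_allI) auto
  then show ?thesis
    by eventually_elim (auto simp: inj_on_def)
qed

section \<open>The threshold as a function of two hash values\<close>

lemma one_good_fun_eq:
  assumes "one_good_fun f" "x \<in> {0<..<1}" "x < f x" "x' \<in> {0<..<1}" "x' < f x"
  shows "f x' = f x"
  using assms by (metis one_good_funE)

text \<open>Move from \<open>(x, y)\<close> to \<open>(x', y)\<close> and then to
  \<open>(x', y')\<close>. Each move changes one retained coordinate to another value below the
  threshold, so the threshold stays; after the first move \<open>y\<close> is therefore still
  retained, which permits the second.\<close>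

lemma one_good_fun_square:
  assumes row: "\<And>y. y \<in> {0<..<1} \<Longrightarrow> one_good_fun (\<lambda>x. f x y)"
    and col: "\<And>x. x \<in> {0<..<1} \<Longrightarrow> one_good_fun (\<lambda>y. f x y)"
    and xy: "x \<in> {0<..<1}" "y \<in> {0<..<1}" "x < f x y" "y < f x y"
    and xy': "x' \<in> {0<..<1}" "y' \<in> {0<..<1}" "x' < f x y" "y' < f x y"
  shows "f x' y' = f x y"
proof -
  have "f x' y = f x y"
    using one_good_fun_eq[OF row[OF xy(2)], of x x'] xy xy' by simp
  moreover from this have "f x' y' = f x' y"
    using one_good_fun_eq[OF col[OF xy'(1)], of y y'] xy xy' by simp
  ultimately show ?thesis by simp
qed

lemma one_good_fun_pair_cases:
  assumes row: "\<And>y. y \<in> {0<..<1} \<Longrightarrow> one_good_fun (\<lambda>x. f x y)"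
    and col: "\<And>x. x \<in> {0<..<1} \<Longrightarrow> one_good_fun (\<lambda>y. f x y)"
  obtains (none) "\<And>x y. x \<in> {0<..<1} \<Longrightarrow> y \<in> {0<..<1} \<Longrightarrow> \<not> (x < f x y \<and> y < f x y)"
  | (square) c where "0 < c" "c \<le> 1"
      "\<And>x y. x \<in> {0<..<1} \<Longrightarrow> y \<in> {0<..<1} \<Longrightarrow> x < f x y \<and> y < f x y \<longleftrightarrow> x < c \<and> y < c"
      "\<And>x y. x \<in> {0<..<1} \<Longrightarrow> y \<in> {0<..<1} \<Longrightarrow> x < c \<Longrightarrow> y < c \<Longrightarrow> f x y = c"
proof (cases "\<exists>x\<in>{0<..<1}. \<exists>y\<in>{0<..<1}. x < f x y \<and> y < f x y")
  case False
  then show thesis by (intro none) auto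
next
  case True
  then obtain x y where xy: "x \<in> {0<..<1}" "y \<in> {0<..<1}" "x < f x y" "y < f x y"
    by blast
  define c where "c = f x y"
  \<comment> \<open>Retention of \<open>x\<close> identifies \<open>f x y\<close> with the bound of
    its row, whence \<open>c \<le> 1\<close>.\<close>
  obtain F where "F \<le> 1" "f x y = F"
    using one_good_funE[OF row[OF xy(2)]] xy by metis
  then have c: "0 < c" "c \<le> 1"
    using xy by (auto simp: c_def)
  have eq: "f x' y' = c" if "x' \<in> {0<..<1}" "y' \<in> {0<..<1}" "x' < c" "y' < c" for x' y'
    using one_good_fun_square[OF row col xy that[unfolded c_def]] by (simp add: c_def)
  have less: "x' < c \<and> y' < c"
    if xy': "x' \<in> {0<..<1}" "y' \<in> {0<..<1}" "x' < f x' y'" "y' < f x' y'" for x' y'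
  proof -
    \<comment> \<open>Both squares contain the componentwise minimum of the two points.\<close>
    have "f (min x x') (min y y') = f x' y'"
      using xy xy' by (intro one_good_fun_square[OF row col xy']) (auto simp: min_def)
    moreover have "f (min x x') (min y y') = c"
      using xy xy' by (intro eq) (auto simp: c_def min_def)
    ultimately show ?thesis using xy' by simp
  qed
  show thesis
  proof (rule square[OF c])
    show "x' < f x' y' \<and> y' < f x' y' \<longleftrightarrow> x' < c \<and> y' < c"
      if "x' \<in> {0<..<1}" "y' \<in> {0<..<1}" for x' y'
      using less[OF that] eq[OF that] by auto
  qed (fact eq)
qed

lemma nn_integral_one_good_fun_pair:
  fixes f :: "real \<Rightarrow> real \<Rightarrow> real"
  assumes row: "\<And>y. y \<in> {0<..<1} \<Longrightarrow> one_good_fun (\<lambda>x. f x y)"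
    and col: "\<And>x. x \<in> {0<..<1} \<Longrightarrow> one_good_fun (\<lambda>y. f x y)"
  defines "v \<equiv> \<lambda>x y. if x < f x y \<and> y < f x y then 1 / (f x y)\<^sup>2 else 0"
  shows "(\<integral>\<^sup>+y. \<integral>\<^sup>+x. ennreal (v x y) \<partial>uniform01 \<partial>uniform01) \<le> 1" (is ?le)
    \<comment> \<open>The added term makes the bound hold even if no point retains both coordinates: the integral is then infinite.\<close>
    and "0 < \<epsilon> \<Longrightarrow>
      1 \<le> (\<integral>\<^sup>+y. \<integral>\<^sup>+x. ennreal (v x y) +
             ennreal (\<epsilon> * (if x < f x y then 1 / (f x y)\<^sup>2 else 0)) \<partial>uniform01 \<partial>uniform01)"
      (is "_ \<Longrightarrow> ?ge \<epsilon>")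
proof -
  have "?le \<and> (0 < \<epsilon> \<longrightarrow> ?ge \<epsilon>)"
  proof (cases rule: one_good_fun_pair_cases[OF row col, case_names _ _ none square])
    case none
    have "(\<integral>\<^sup>+y. \<integral>\<^sup>+x. ennreal (v x y) \<partial>uniform01 \<partial>uniform01)
        = (\<integral>\<^sup>+y. \<integral>\<^sup>+x. 0 \<partial>uniform01 \<partial>uniform01)"
      using none by (intro nn_integral_cong) (auto simp: v_def space_uniform01)
    moreover have "?ge \<epsilon>" if "0 < \<epsilon>"
    proof -
      have inner: "ennreal \<epsilon> * ennreal (1 / y)
          \<le> (\<integral>\<^sup>+x. ennreal (\<epsilon> * (if x < f x y then 1 / (f x y)\<^sup>2 else 0)) \<partial>uniform01)"
        if y: "y \<in> {0<..<1}" for y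
      proof -
        obtain F where F: "0 < F" "F \<le> 1"
          "\<And>x. x \<in> {0<..<1} \<Longrightarrow> x < f x y \<longleftrightarrow> x < F"
          "\<And>x. x \<in> {0<..<1} \<Longrightarrow> x < F \<Longrightarrow> f x y = F"
          using one_good_funE[OF row[OF y]] by metis
        \<comment> \<open>Otherwise the point \<open>(F / 2, y)\<close> would have threshold
          \<open>F\<close> above both of its coordinates, contrary to \<open>none\<close>.\<close>
        have "F \<le> y"
          using none[of "F / 2" y] F(1,2) F(4)[of "F / 2"] y by auto
        \<comment> \<open>The row contributes \<open>F / F\<^sup>2 = 1 / F\<close>, which is at
          least \<open>1 / y\<close>.\<close>
        have "ennreal \<epsilon> * ennreal (1 / y) \<le> ennreal (\<epsilon> * (1 / F\<^sup>2)) * ennreal F"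
          using \<open>0 < \<epsilon>\<close> \<open>F \<le> y\<close> F(1)
          by (simp add: ennreal_mult[symmetric] power2_eq_square field_simps)
        also have "\<dots> = (\<integral>\<^sup>+x. (if x < F then ennreal (\<epsilon> * (1 / F\<^sup>2)) else 0) \<partial>uniform01)"
          using F by (simp add: nn_integral_uniform01_less)
        also have "\<dots> = (\<integral>\<^sup>+x. ennreal (\<epsilon> * (if x < f x y then 1 / (f x y)\<^sup>2 else 0)) \<partial>uniform01)"
          using F by (intro nn_integral_cong) (auto simp: space_uniform01)
        finally show ?thesis .
      qed
      have "(\<infinity>::ennreal) = ennreal \<epsilon> * (\<integral>\<^sup>+y. ennreal (1 / y) \<partial>uniform01)"
        using \<open>0 < \<epsilon>\<close> by (simp add: nn_integral_uniform01_inverse ennreal_mult_top)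
      also have "\<dots> = (\<integral>\<^sup>+y. ennreal \<epsilon> * ennreal (1 / y) \<partial>uniform01)"
        by (rule nn_integral_cmult[symmetric]) measurable
      also have "\<dots> \<le> (\<integral>\<^sup>+y. \<integral>\<^sup>+x. ennreal (v x y) +
             ennreal (\<epsilon> * (if x < f x y then 1 / (f x y)\<^sup>2 else 0)) \<partial>uniform01 \<partial>uniform01)"
        by (intro nn_integral_mono order_trans[OF inner])
          (auto simp: space_uniform01 intro!: nn_integral_mono)
      finally show ?thesis
        by (simp add: top_unique)
    qed
    ultimately show ?thesis by simp
  next
    case (square c)
    \<comment> \<open>Each of the two integrations over the square contributes one factor
      \<open>c\<close>, cancelling the value \<open>1 / c\<^sup>2\<close>; the total is 1.\<close>
    have inner: "(\<integral>\<^sup>+x. ennreal (v x y) \<partial>uniform01) = (if y < c then ennreal (1 / c) else 0)"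
      if "y \<in> {0<..<1}" for y
    proof -
      have "(\<integral>\<^sup>+x. ennreal (v x y) \<partial>uniform01)
          = (\<integral>\<^sup>+x. (if x < c then (if y < c then ennreal (1 / c\<^sup>2) else 0) else 0) \<partial>uniform01)"
        using square that by (intro nn_integral_cong) (auto simp: v_def space_uniform01)
      also have "\<dots> = (if y < c then ennreal (1 / c\<^sup>2) else 0) * ennreal c"
        using square by (simp add: nn_integral_uniform01_less)
      finally show ?thesis
        using square(1) by (simp add: ennreal_mult[symmetric] power2_eq_square)
    qed
    have "(\<integral>\<^sup>+y. \<integral>\<^sup>+x. ennreal (v x y) \<partial>uniform01 \<partial>uniform01)
        = (\<integral>\<^sup>+y. (if y < c then ennreal (1 / c) else 0) \<partial>uniform01)"
      by (intro nn_integral_cong) (simp add: inner space_uniform01)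
    also have "\<dots> = 1"
      using square(1,2) by (simp add: nn_integral_uniform01_less ennreal_mult[symmetric])
    finally have *: "(\<integral>\<^sup>+y. \<integral>\<^sup>+x. ennreal (v x y) \<partial>uniform01 \<partial>uniform01) = 1" .
    then have "?ge \<epsilon>"
      by (subst *[symmetric]) (intro nn_integral_mono, simp)
    with * show ?thesis by simp
  qed
  then show ?le "0 < \<epsilon> \<Longrightarrow> ?ge \<epsilon>" by auto
qed

section \<open>Moments of the weights of retained identifiers\<close>

text \<open>Streams and target size are abstracted away, so that the threshold of one stream and a
  minimum over several are treated alike. Goodness is asked at every identifier, since a minimum
  also involves streams in which a given identifier does not occur.\<close>

definition good_threshold :: "nat \<Rightarrow> (hash \<Rightarrow> real) \<Rightarrow> bool" where
  "good_threshold n \<tau> \<longleftrightarrow> \<tau> \<in> borel_measurable (random_hash n) \<and>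
     (\<forall>i\<in>{1..n}. \<forall>h\<in>hashes n. one_good_fun (\<lambda>x. \<tau> (h(i := x))))"

text \<open>The Horvitz-Thompson weight: with the other hash values fixed, the inclusion probability
  of a retained identifier is \<open>\<tau> h\<close>.\<close>

definition weight :: "(hash \<Rightarrow> real) \<Rightarrow> nat \<Rightarrow> hash \<Rightarrow> real" where
  "weight \<tau> i h = (if h i < \<tau> h then 1 / \<tau> h else 0)"

text \<open>A nonzero weight comes with \<open>0 < h i < \<tau> h\<close>.\<close>

lemma weight_nonneg: "h \<in> hashes n \<Longrightarrow> i \<in> {1..n} \<Longrightarrow> 0 \<le> weight \<tau> i h"
  by (force simp: weight_def hashes_def PiE_def Pi_def)

lemma measurable_weight:
  assumes "good_threshold n \<tau>" "i \<in> {1..n}"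
  shows "weight \<tau> i \<in> borel_measurable (random_hash n)"
proof -
  have [measurable]: "\<tau> \<in> borel_measurable (random_hash n)"
    using assms(1) by (simp add: good_threshold_def)
  note [measurable] = measurable_random_hash_component[OF assms(2)]
  show ?thesis unfolding weight_def by measurable
qed

text \<open>The weight is \<open>1 / F\<close> on an event of probability \<open>F\<close> and 0
  elsewhere; \<open>0 < p\<close> makes its power vanish there too. The value of
  \<open>\<tau>\<close> below \<open>F\<close> is exported so that the bounds of two thresholds can
  be compared.\<close>

lemma nn_integral_weight_power:
  assumes \<tau>: "good_threshold n \<tau>" and i: "i \<in> {1..n}" and h: "h \<in> hashes n"
  obtains F where "0 < F" "F \<le> 1" "\<And>x. x \<in> {0<..<1} \<Longrightarrow> x < F \<Longrightarrow> \<tau> (h(i := x)) = F"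
    "\<And>p. 0 < p \<Longrightarrow> (\<integral>\<^sup>+x. ennreal (weight \<tau> i (h(i := x)) ^ p) \<partial>uniform01) = ennreal (F / F ^ p)"
proof -
  have good: "one_good_fun (\<lambda>x. \<tau> (h(i := x)))"
    using \<tau> i h by (simp add: good_threshold_def)
  obtain F where F: "0 < F" "F \<le> 1"
      "\<And>x. x \<in> {0<..<1} \<Longrightarrow> x < \<tau> (h(i := x)) \<longleftrightarrow> x < F"
      "\<And>x. x \<in> {0<..<1} \<Longrightarrow> x < F \<Longrightarrow> \<tau> (h(i := x)) = F"
    by (rule one_good_funE[OF good]) (rule that)
  have "(\<integral>\<^sup>+x. ennreal (weight \<tau> i (h(i := x)) ^ p) \<partial>uniform01) = ennreal (F / F ^ p)" if "0 < p" for p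
  proof -
    have "(\<integral>\<^sup>+x. ennreal (weight \<tau> i (h(i := x)) ^ p) \<partial>uniform01)
        = (\<integral>\<^sup>+x. (if x < F then ennreal (1 / F ^ p) else 0) \<partial>uniform01)"
      using F that by (intro nn_integral_cong) (auto simp: weight_def space_uniform01 power_one_over)
    also have "\<dots> = ennreal (F / F ^ p)"
      using F(1,2) by (simp add: nn_integral_uniform01_less ennreal_mult[symmetric])
    finally show ?thesis .
  qed
  with F show thesis by (intro that) auto
qed

lemma nn_integral_weight:
  assumes "good_threshold n \<tau>" "i \<in> {1..n}"
  shows "(\<integral>\<^sup>+h. ennreal (weight \<tau> i h) \<partial>random_hash n) = 1"
proof -
  interpret prob_space "random_hash n" by (rule prob_space_random_hash)
  note [measurable] = measurable_weight[OF assms]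
  have "(\<integral>\<^sup>+x. ennreal (weight \<tau> i (h(i := x))) \<partial>uniform01) = 1" if "h \<in> hashes n" for h
  proof (rule nn_integral_weight_power[OF assms that])
    fix F assume "0 < F"
      "\<And>p. 0 < p \<Longrightarrow> (\<integral>\<^sup>+x. ennreal (weight \<tau> i (h(i := x)) ^ p) \<partial>uniform01) = ennreal (F / F ^ p)"
    from this(1) this(2)[of 1] show ?thesis by simp
  qed
  then have "(\<integral>\<^sup>+h. \<integral>\<^sup>+x. ennreal (weight \<tau> i (h(i := x))) \<partial>uniform01 \<partial>random_hash n)
      = (\<integral>\<^sup>+h. 1 \<partial>random_hash n)"
    by (intro nn_integral_cong) (simp add: space_random_hash)
  then show ?thesis
    by (subst nn_integral_random_hash_resample[OF assms(2)]) (simp_all add: emeasure_space_1)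
qed

lemma nn_integral_weight_square_mono:
  assumes \<sigma>: "good_threshold n \<sigma>" and \<tau>: "good_threshold n \<tau>" and i: "i \<in> {1..n}"
    and le: "\<And>h. h \<in> hashes n \<Longrightarrow> \<sigma> h \<le> \<tau> h"
  shows "(\<integral>\<^sup>+h. ennreal ((weight \<tau> i h)\<^sup>2) \<partial>random_hash n)
       \<le> (\<integral>\<^sup>+h. ennreal ((weight \<sigma> i h)\<^sup>2) \<partial>random_hash n)"
proof -
  note [measurable] = measurable_weight[OF \<sigma> i] measurable_weight[OF \<tau> i]
  have "(\<integral>\<^sup>+x. ennreal ((weight \<tau> i (h(i := x)))\<^sup>2) \<partial>uniform01)
      \<le> (\<integral>\<^sup>+x. ennreal ((weight \<sigma> i (h(i := x)))\<^sup>2) \<partial>uniform01)" if h: "h \<in> hashes n" for h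
  proof -
    obtain F where F: "0 < F" "F \<le> 1" "\<And>x. x \<in> {0<..<1} \<Longrightarrow> x < F \<Longrightarrow> \<sigma> (h(i := x)) = F"
      "\<And>p. 0 < p \<Longrightarrow> (\<integral>\<^sup>+x. ennreal (weight \<sigma> i (h(i := x)) ^ p) \<partial>uniform01) = ennreal (F / F ^ p)"
      using nn_integral_weight_power[OF \<sigma> i h] by metis
    obtain G where G: "0 < G" "G \<le> 1" "\<And>x. x \<in> {0<..<1} \<Longrightarrow> x < G \<Longrightarrow> \<tau> (h(i := x)) = G"
      "\<And>p. 0 < p \<Longrightarrow> (\<integral>\<^sup>+x. ennreal (weight \<tau> i (h(i := x)) ^ p) \<partial>uniform01) = ennreal (G / G ^ p)"
      using nn_integral_weight_power[OF \<tau> i h] by metis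
    \<comment> \<open>A common point of both retention intervals; there the two thresholds equal
      \<open>F\<close> and \<open>G\<close>, so \<open>\<sigma> \<le> \<tau>\<close> yields
      \<open>F \<le> G\<close>.\<close>
    define x where "x = min F G / 2"
    have x: "x \<in> {0<..<1}" "x < F" "x < G"
      using F(1,2) G(1) by (auto simp: x_def min_def)
    have "F \<le> G"
      using F(3)[OF x(1,2)] G(3)[OF x(1,3)] le[OF hashes_fun_upd[OF h i x(1)]] by simp
    then have "ennreal (G / G\<^sup>2) \<le> ennreal (F / F\<^sup>2)"
      using F(1) G(1) by (intro ennreal_leI) (simp add: power2_eq_square field_simps)
    then show ?thesis
      using F(4)[of 2] G(4)[of 2] by simp
  qed
  then have "(\<integral>\<^sup>+h. \<integral>\<^sup>+x. ennreal ((weight \<tau> i (h(i := x)))\<^sup>2) \<partial>uniform01 \<partial>random_hash n)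
      \<le> (\<integral>\<^sup>+h. \<integral>\<^sup>+x. ennreal ((weight \<sigma> i (h(i := x)))\<^sup>2) \<partial>uniform01 \<partial>random_hash n)"
    by (intro nn_integral_mono[of "random_hash n"]) (simp add: space_random_hash)
  then show ?thesis
    by (subst (1 2) nn_integral_random_hash_resample[OF i]) simp_all
qed

lemma nn_integral_random_hash_resample2:
  assumes i: "i \<in> {1..n}" and j: "j \<in> {1..n}" and f: "f \<in> borel_measurable (random_hash n)"
  shows "(\<integral>\<^sup>+h. f h \<partial>random_hash n)
       = (\<integral>\<^sup>+h. \<integral>\<^sup>+y. \<integral>\<^sup>+x. f (h(j := y, i := x)) \<partial>uniform01 \<partial>uniform01 \<partial>random_hash n)"
  using nn_integral_random_hash_resample[OF i f]
    nn_integral_random_hash_resample[OF j borel_measurable_random_hash_resample[OF i f]]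
  by simp

text \<open>Redrawing the hash values of \<open>i\<close> and \<open>j\<close> reduces both bounds
  to the two-variable ones. The correction term there integrates to \<open>\<epsilon>\<close> times
  the second moment of the weight of \<open>i\<close>; when that moment is finite, the correction
  can be made arbitrarily small.\<close>

lemma nn_integral_weight_mult:
  assumes \<tau>: "good_threshold n \<tau>" and i: "i \<in> {1..n}" and j: "j \<in> {1..n}" and "i \<noteq> j"
  shows "(\<integral>\<^sup>+h. ennreal (weight \<tau> i h * weight \<tau> j h) \<partial>random_hash n) \<le> 1" (is "?I \<le> 1")
    and "(\<integral>\<^sup>+h. ennreal ((weight \<tau> i h)\<^sup>2) \<partial>random_hash n) < \<infinity> \<Longrightarrow>
      1 \<le> (\<integral>\<^sup>+h. ennreal (weight \<tau> i h * weight \<tau> j h) \<partial>random_hash n)"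
proof -
  interpret prob_space "random_hash n" by (rule prob_space_random_hash)
  note [measurable] = measurable_weight[OF \<tau> i] measurable_weight[OF \<tau> j]
  have row: "one_good_fun (\<lambda>x. \<tau> (h(j := y, i := x)))"
    and col: "one_good_fun (\<lambda>z. \<tau> (h(j := z, i := y)))"
    if "h \<in> hashes n" "y \<in> {0<..<1}" for h y
  proof -
    show "one_good_fun (\<lambda>x. \<tau> (h(j := y, i := x)))"
      using \<tau> i hashes_fun_upd[OF that(1) j that(2)] by (simp add: good_threshold_def)
    \<comment> \<open>Updates at distinct identifiers commute, so either one may be regarded as the
      last.\<close>
    have "one_good_fun (\<lambda>z. \<tau> (h(i := y, j := z)))"
      using \<tau> j hashes_fun_upd[OF that(1) i that(2)] by (simp add: good_threshold_def)
    then show "one_good_fun (\<lambda>z. \<tau> (h(j := z, i := y)))"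
      using \<open>i \<noteq> j\<close> by (simp add: fun_upd_twist)
  qed
  have w: "weight \<tau> i (h(j := y, i := x)) * weight \<tau> j (h(j := y, i := x)) =
      (if x < \<tau> (h(j := y, i := x)) \<and> y < \<tau> (h(j := y, i := x)) then 1 / (\<tau> (h(j := y, i := x)))\<^sup>2 else 0)"
    "(weight \<tau> i (h(j := y, i := x)))\<^sup>2 =
      (if x < \<tau> (h(j := y, i := x)) then 1 / (\<tau> (h(j := y, i := x)))\<^sup>2 else 0)" for h x y
    using \<open>i \<noteq> j\<close> by (simp_all add: weight_def power2_eq_square)
  have "?I \<le> (\<integral>\<^sup>+h. 1 \<partial>random_hash n)"
    by (subst nn_integral_random_hash_resample2[OF i j], measurable, rule nn_integral_mono)
      (simp only: w space_random_hash, rule nn_integral_one_good_fun_pair(1)[OF row col])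
  then show "?I \<le> 1" by (simp add: emeasure_space_1)
  show "1 \<le> ?I" if finite_square: "(\<integral>\<^sup>+h. ennreal ((weight \<tau> i h)\<^sup>2) \<partial>random_hash n) < \<infinity>"
  proof (rule ennreal_le_epsilon)
    fix e :: real assume "0 < e"
    obtain m where m: "(\<integral>\<^sup>+h. ennreal ((weight \<tau> i h)\<^sup>2) \<partial>random_hash n) = ennreal m" "0 \<le> m"
      using finite_square by (cases "\<integral>\<^sup>+h. ennreal ((weight \<tau> i h)\<^sup>2) \<partial>random_hash n") auto
    \<comment> \<open>The summand 1 keeps the denominator positive when
      \<open>m = 0\<close>.\<close>
    define \<epsilon> where "\<epsilon> = e / (m + 1)"
    have \<epsilon>: "0 < \<epsilon>" "\<epsilon> * m \<le> e"
      using \<open>0 < e\<close> m(2) by (auto simp: \<epsilon>_def field_simps)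
    have "(\<integral>\<^sup>+h. 1 \<partial>random_hash n) \<le>
        (\<integral>\<^sup>+h. ennreal (weight \<tau> i h * weight \<tau> j h) + ennreal (\<epsilon> * (weight \<tau> i h)\<^sup>2) \<partial>random_hash n)"
      by (subst nn_integral_random_hash_resample2[OF i j], measurable, rule nn_integral_mono)
        (simp only: w space_random_hash, rule nn_integral_one_good_fun_pair(2)[OF row col \<epsilon>(1)])
    also have "\<dots> = ?I + ennreal \<epsilon> * ennreal m"
      using \<epsilon>(1) by (simp add: nn_integral_add nn_integral_cmult ennreal_mult' flip: m(1))
    also have "\<dots> \<le> ?I + ennreal e"
      using \<epsilon> m(2) by (intro add_left_mono) (simp add: ennreal_mult[symmetric] ennreal_leI)
    finally show "1 \<le> ?I + ennreal e"
      by (simp add: emeasure_space_1)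
  qed
qed

text \<open>Expand both squares and compare term by term: the diagonal by monotonicity of second
  moments, the rest because mixed moments are at most 1 for \<open>\<tau>\<close> and at least 1 for
  \<open>\<sigma>\<close>. The lower bound requires finite second moments for
  \<open>\<sigma>\<close>, whence the case split.\<close>

lemma nn_integral_sum_weight_square_mono:
  assumes \<sigma>: "good_threshold n \<sigma>" and \<tau>: "good_threshold n \<tau>" and Q: "Q \<subseteq> {1..n}"
    and le: "\<And>h. h \<in> hashes n \<Longrightarrow> \<sigma> h \<le> \<tau> h"
  shows "(\<integral>\<^sup>+h. ennreal ((\<Sum>i\<in>Q. weight \<tau> i h)\<^sup>2) \<partial>random_hash n)
       \<le> (\<integral>\<^sup>+h. ennreal ((\<Sum>i\<in>Q. weight \<sigma> i h)\<^sup>2) \<partial>random_hash n)"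
proof -
  have fin: "finite Q"
    using Q finite_subset by blast
  have expand: "(\<integral>\<^sup>+h. ennreal ((\<Sum>i\<in>Q. weight \<rho> i h)\<^sup>2) \<partial>random_hash n)
      = (\<Sum>i\<in>Q. \<Sum>j\<in>Q. \<integral>\<^sup>+h. ennreal (weight \<rho> i h * weight \<rho> j h) \<partial>random_hash n)"
    if \<rho>: "good_threshold n \<rho>" for \<rho>
  proof -
    have meas: "(\<lambda>h. ennreal (weight \<rho> i h * weight \<rho> j h)) \<in> borel_measurable (random_hash n)"
      if "i \<in> Q" "j \<in> Q" for i j
    proof -
      note [measurable] = measurable_weight[OF \<rho> subsetD[OF Q that(1)]]
        measurable_weight[OF \<rho> subsetD[OF Q that(2)]]
      show ?thesis by measurable
    qed
    have "(\<integral>\<^sup>+h. ennreal ((\<Sum>i\<in>Q. weight \<rho> i h)\<^sup>2) \<partial>random_hash n)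
        = (\<integral>\<^sup>+h. (\<Sum>i\<in>Q. \<Sum>j\<in>Q. ennreal (weight \<rho> i h * weight \<rho> j h)) \<partial>random_hash n)"
    proof (rule nn_integral_cong)
      fix h assume "h \<in> space (random_hash n)"
      then have nonneg: "0 \<le> weight \<rho> i h" if "i \<in> Q" for i
        using weight_nonneg[of h n i] that Q by (auto simp: space_random_hash)
      show "ennreal ((\<Sum>i\<in>Q. weight \<rho> i h)\<^sup>2)
          = (\<Sum>i\<in>Q. \<Sum>j\<in>Q. ennreal (weight \<rho> i h * weight \<rho> j h))"
        by (simp add: power2_eq_square sum_product sum_ennreal nonneg sum_nonneg)
    qed
    also have "\<dots> = (\<Sum>i\<in>Q. \<Sum>j\<in>Q. \<integral>\<^sup>+h. ennreal (weight \<rho> i h * weight \<rho> j h) \<partial>random_hash n)"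
      by (subst nn_integral_sum, intro borel_measurable_sum meas, assumption+,
          intro sum.cong refl nn_integral_sum meas)
    finally show ?thesis .
  qed
  show ?thesis
  proof (cases "\<exists>i\<in>Q. (\<integral>\<^sup>+h. ennreal ((weight \<sigma> i h)\<^sup>2) \<partial>random_hash n) = \<infinity>")
    case True
    then obtain i where i: "i \<in> Q" "(\<integral>\<^sup>+h. ennreal ((weight \<sigma> i h)\<^sup>2) \<partial>random_hash n) = \<infinity>"
      by blast
    \<comment> \<open>A sum of nonnegative weights dominates each of them, so one infinite second
      moment makes the right-hand side infinite.\<close>
    have "(\<integral>\<^sup>+h. ennreal ((weight \<sigma> i h)\<^sup>2) \<partial>random_hash n)
        \<le> (\<integral>\<^sup>+h. ennreal ((\<Sum>i\<in>Q. weight \<sigma> i h)\<^sup>2) \<partial>random_hash n)"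
    proof (intro nn_integral_mono ennreal_leI power_mono)
      fix h assume "h \<in> space (random_hash n)"
      then have nonneg: "0 \<le> weight \<sigma> i h" if "i \<in> Q" for i
        using weight_nonneg[of h n i] that Q by (auto simp: space_random_hash)
      then show "weight \<sigma> i h \<le> (\<Sum>i\<in>Q. weight \<sigma> i h)" "0 \<le> weight \<sigma> i h"
        using i(1) fin by (auto intro: member_le_sum)
    qed
    with i(2) show ?thesis by (simp add: top_unique)
  next
    case False
    then have fin2: "(\<integral>\<^sup>+h. ennreal ((weight \<sigma> i h)\<^sup>2) \<partial>random_hash n) < \<infinity>" if "i \<in> Q" for i
      using that by (auto simp: top.not_eq_extremum)
    have "(\<integral>\<^sup>+h. ennreal (weight \<tau> i h * weight \<tau> j h) \<partial>random_hash n)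
        \<le> (\<integral>\<^sup>+h. ennreal (weight \<sigma> i h * weight \<sigma> j h) \<partial>random_hash n)" if "i \<in> Q" "j \<in> Q" for i j
    proof (cases "i = j")
      case True
      then show ?thesis
        using nn_integral_weight_square_mono[OF \<sigma> \<tau> _ le, of i] that Q
        by (auto simp: power2_eq_square)
    next
      case False
      with that Q nn_integral_weight_mult(1)[OF \<tau>, of i j] nn_integral_weight_mult(2)[OF \<sigma>, of i j]
        fin2[OF that(1)] show ?thesis
        by (meson order_trans subsetD)
    qed
    then show ?thesis
      by (simp add: expand \<sigma> \<tau> sum_mono)
  qed
qed

section \<open>Variances and second moments\<close>

text \<open>The identity of variance and second moment without subtraction, so that it holds with
  infinite values: the cross term is moved across in
  \<open>(X - m)\<^sup>2 + 2 * m * X = X\<^sup>2 + m\<^sup>2\<close>, and \<open>2 * m * X\<close>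
  has mean \<open>2 * m\<^sup>2\<close>.\<close>

lemma evariance_add:
  assumes M: "prob_space M" and X [measurable]: "X \<in> borel_measurable M" and nonneg: "AE \<omega> in M. 0 \<le> X \<omega>"
    and m: "0 \<le> m" "(\<integral>\<^sup>+\<omega>. ennreal (X \<omega>) \<partial>M) = ennreal m"
  shows "evariance M X + ennreal (2 * m\<^sup>2) = (\<integral>\<^sup>+\<omega>. ennreal ((X \<omega>)\<^sup>2) \<partial>M) + ennreal (m\<^sup>2)"
proof -
  interpret prob_space M by fact
  have mean: "integral\<^sup>L M X = m"
    using m by (simp add: integral_eq_nn_integral[OF X nonneg])
  have "evariance M X + ennreal (2 * m\<^sup>2)
      = (\<integral>\<^sup>+\<omega>. ennreal ((X \<omega> - m)\<^sup>2) \<partial>M) + ennreal (2 * m) * (\<integral>\<^sup>+\<omega>. ennreal (X \<omega>) \<partial>M)"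
    unfolding evariance_def mean m(2) using m(1)
    by (simp add: ennreal_mult[symmetric] power2_eq_square mult.assoc)
  also have "\<dots> = (\<integral>\<^sup>+\<omega>. ennreal ((X \<omega> - m)\<^sup>2) + ennreal (2 * m) * ennreal (X \<omega>) \<partial>M)"
    by (simp add: nn_integral_add nn_integral_cmult)
  also have "\<dots> = (\<integral>\<^sup>+\<omega>. ennreal ((X \<omega>)\<^sup>2) + ennreal (m\<^sup>2) \<partial>M)"
  proof (rule nn_integral_cong_AE)
    show "AE \<omega> in M. ennreal ((X \<omega> - m)\<^sup>2) + ennreal (2 * m) * ennreal (X \<omega>)
        = ennreal ((X \<omega>)\<^sup>2) + ennreal (m\<^sup>2)"
      using nonneg
    proof eventually_elim
      case (elim \<omega>)
      have "(X \<omega> - m)\<^sup>2 + 2 * m * X \<omega> = (X \<omega>)\<^sup>2 + m\<^sup>2"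
        by (simp add: power2_diff)
      then show ?case
        using elim m(1) by (simp add: ennreal_mult[symmetric] ennreal_plus[symmetric] del: ennreal_plus)
    qed
  qed
  also have "\<dots> = (\<integral>\<^sup>+\<omega>. ennreal ((X \<omega>)\<^sup>2) \<partial>M) + ennreal (m\<^sup>2)"
    by (simp add: nn_integral_add emeasure_space_1)
  finally show ?thesis .
qed

lemma evariance_mono:
  assumes M: "prob_space M" and X: "X \<in> borel_measurable M" "AE \<omega> in M. 0 \<le> X \<omega>"
    and Y: "Y \<in> borel_measurable M" "AE \<omega> in M. 0 \<le> Y \<omega>"
    and m: "0 \<le> m" "(\<integral>\<^sup>+\<omega>. ennreal (X \<omega>) \<partial>M) = ennreal m" "(\<integral>\<^sup>+\<omega>. ennreal (Y \<omega>) \<partial>M) = ennreal m"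
    and le: "(\<integral>\<^sup>+\<omega>. ennreal ((X \<omega>)\<^sup>2) \<partial>M) \<le> (\<integral>\<^sup>+\<omega>. ennreal ((Y \<omega>)\<^sup>2) \<partial>M)"
  shows "evariance M X \<le> evariance M Y"
proof -
  have "ennreal (2 * m\<^sup>2) + evariance M X \<le> ennreal (2 * m\<^sup>2) + evariance M Y"
    using evariance_add[OF M X m(1,2)] evariance_add[OF M Y m(1,3)] le
    by (simp add: add.commute add_right_mono)
  then show ?thesis
    \<comment> \<open>Cancellation is sound since \<open>2 * m\<^sup>2\<close> is finite.\<close>
    by (subst (asm) ennreal_add_left_cancel_le) auto
qed

section \<open>The estimator as a sum of weights\<close>

text \<open>Choosing the least index for each value turns a count of distinct values into a count of
  indices defined by comparisons, whose measurability can be checked.\<close>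

lemma card_image_least_representatives:
  fixes B :: "'a::linorder set"
  assumes "finite B"
  shows "card (f ` B) = card {i \<in> B. \<forall>j\<in>B. j < i \<longrightarrow> f j \<noteq> f i}" (is "_ = card ?R")
proof -
  have "inj_on f ?R"
    by (rule inj_onI) (metis (mono_tags, lifting) linorder_less_linear mem_Collect_eq)
  then have "card (f ` ?R) = card ?R"
    by (rule card_image)
  moreover have "f ` ?R = f ` B"
  proof (intro equalityI subsetI)
    fix y assume "y \<in> f ` B"
    then have ne: "finite {i \<in> B. f i = y}" "{i \<in> B. f i = y} \<noteq> {}"
      using assms by auto
    define m where "m = Min {i \<in> B. f i = y}"
    have m: "m \<in> B" "f m = y"
      using Min_in[OF ne] by (auto simp: m_def)
    have "f j \<noteq> f m" if "j \<in> B" "j < m" for j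
      using Min_le[OF ne(1), of j] that m(2) by (auto simp flip: m_def)
    with m show "y \<in> f ` ?R" by auto
  qed auto
  ultimately show ?thesis
    by simp
qed

text \<open>Almost sure equality with a sum of weights does not by itself give measurability, so
  hash functions with collisions are covered as well.\<close>

lemma measurable_estimate:
  assumes \<tau> [measurable]: "\<tau> \<in> borel_measurable (random_hash n)"
    and U: "U \<subseteq> {1..n}" and P: "P \<subseteq> {1..n}"
  shows "(\<lambda>h. estimate P h (\<tau> h, {x \<in> h ` U. x < \<tau> h})) \<in> borel_measurable (random_hash n)"
proof -
  have fin [simp]: "finite U" "finite P"
    using U P finite_subset by blast+
  \<comment> \<open>The property is tested on hash values: under a collision an identifier outside
    \<open>P\<close> counts if it shares its value with one in \<open>P\<close>.\<close>
  define B where "B h = {i \<in> U. h i < \<tau> h \<and> (\<exists>j\<in>P. h j = h i)}" for h :: hash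
  have finB: "finite (B h)" for h
    by (simp add: B_def)
  have B: "with_property P h {x \<in> h ` U. x < \<tau> h} = h ` B h" for h
    unfolding with_property_def B_def by auto
  have card: "real (card (h ` B h))
      = (\<Sum>i\<in>U. if i \<in> B h \<and> (\<forall>j\<in>U. j \<in> B h \<longrightarrow> j < i \<longrightarrow> h j \<noteq> h i) then 1 else 0)" for h
  proof -
    have "{i \<in> B h. \<forall>j\<in>B h. j < i \<longrightarrow> h j \<noteq> h i}
        = {i \<in> U. i \<in> B h \<and> (\<forall>j\<in>U. j \<in> B h \<longrightarrow> j < i \<longrightarrow> h j \<noteq> h i)}"
      by (auto simp: B_def)
    then show ?thesis
      by (simp add: card_image_least_representatives[OF finB] sum.If_cases Int_def)
  qed
  have comp [measurable]: "(\<lambda>h. h i) \<in> borel_measurable (random_hash n)" if "i \<in> {1..n}" for i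
    using that by (rule measurable_random_hash_component)
  have eq: "Measurable.pred (random_hash n) (\<lambda>h. h i = h j)" if "i \<in> {1..n}" "j \<in> {1..n}" for i j
  proof -
    note [measurable] = that[THEN measurable_random_hash_component]
    show ?thesis unfolding pred_def by measurable
  qed
  have B_meas: "Measurable.pred (random_hash n) (\<lambda>h. i \<in> B h)" if "i \<in> U" for i
  proof -
    have "Measurable.pred (random_hash n) (\<lambda>h. h i < \<tau> h \<and> (\<exists>j\<in>P. h j = h i))"
      using that U P
      by (intro pred_intros_logic pred_intros_finite borel_measurable_less eq comp \<tau> fin) auto
    with that show ?thesis by (simp add: B_def)
  qed
  have "Measurable.pred (random_hash n)
      (\<lambda>h. i \<in> B h \<and> (\<forall>j\<in>U. j \<in> B h \<longrightarrow> j < i \<longrightarrow> h j \<noteq> h i))" if "i \<in> U" for i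
    using that U
    by (intro pred_intros_logic pred_intros_finite B_meas eq fin) auto
  then have "(\<lambda>h. real (card (h ` B h))) \<in> borel_measurable (random_hash n)"
    unfolding card by (intro borel_measurable_sum measurable_If) auto
  then show ?thesis
    unfolding estimate_def by (simp add: B)
qed

lemma AE_estimate_eq_sum_weight:
  assumes "U \<subseteq> {1..n}" "P \<subseteq> {1..n}"
  shows "AE h in random_hash n. estimate P h (\<tau> h, {x \<in> h ` U. x < \<tau> h}) = (\<Sum>i\<in>P \<inter> U. weight \<tau> i h)"
  using AE_random_hash_inj
proof eventually_elim
  case (elim h)
  have fin: "finite U"
    using assms(1) finite_subset by blast
  \<comment> \<open>By injectivity the identifier in \<open>P\<close> with the same hash value is
    the retained identifier itself.\<close>
  have "with_property P h {x \<in> h ` U. x < \<tau> h} = h ` {i \<in> P \<inter> U. h i < \<tau> h}"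
    using elim assms by (fastforce simp: with_property_def inj_on_def)
  moreover have "inj_on h {i \<in> P \<inter> U. h i < \<tau> h}"
    using elim assms by (auto intro: inj_on_subset)
  ultimately have "estimate P h (\<tau> h, {x \<in> h ` U. x < \<tau> h}) = (\<Sum>i | i \<in> P \<inter> U \<and> h i < \<tau> h. 1 / \<tau> h)"
    by (simp add: estimate_def card_image)
  also have "\<dots> = (\<Sum>i\<in>P \<inter> U. weight \<tau> i h)"
    using fin by (simp add: weight_def sum.If_cases Int_def conj_ac)
  finally show ?case .
qed

text \<open>Both estimators have mean \<open>card (P \<inter> U)\<close>, so only second moments
  have to be compared. Here \<open>\<sigma>\<close> is the smaller threshold, not a standard
  deviation.\<close>

lemma evariance_estimate_mono:
  assumes \<sigma>: "good_threshold n \<sigma>" and \<tau>: "good_threshold n \<tau>"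
    and U: "U \<subseteq> {1..n}" and P: "P \<subseteq> {1..n}"
    and le: "\<And>h. h \<in> hashes n \<Longrightarrow> \<sigma> h \<le> \<tau> h"
  shows "evariance (random_hash n) (\<lambda>h. estimate P h (\<tau> h, {x \<in> h ` U. x < \<tau> h}))
       \<le> evariance (random_hash n) (\<lambda>h. estimate P h (\<sigma> h, {x \<in> h ` U. x < \<sigma> h}))"
proof -
  have nonneg: "0 \<le> weight \<rho> i h" if "i \<in> P \<inter> U" "h \<in> space (random_hash n)" for \<rho> i h
    using weight_nonneg[of h n i] that U by (auto simp: space_random_hash)
  have meas: "(\<lambda>h. estimate P h (\<rho> h, {x \<in> h ` U. x < \<rho> h})) \<in> borel_measurable (random_hash n)"
    if "good_threshold n \<rho>" for \<rho>
    using that by (intro measurable_estimate U P) (simp add: good_threshold_def)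
  have pos: "AE h in random_hash n. 0 \<le> estimate P h (\<rho> h, {x \<in> h ` U. x < \<rho> h})" for \<rho>
    using AE_estimate_eq_sum_weight[OF U P, of \<rho>] AE_space
    by eventually_elim (auto intro!: sum_nonneg nonneg)
  have mean: "(\<integral>\<^sup>+h. ennreal (estimate P h (\<rho> h, {x \<in> h ` U. x < \<rho> h})) \<partial>random_hash n)
      = ennreal (real (card (P \<inter> U)))" if \<rho>: "good_threshold n \<rho>" for \<rho>
  proof -
    have "(\<integral>\<^sup>+h. ennreal (estimate P h (\<rho> h, {x \<in> h ` U. x < \<rho> h})) \<partial>random_hash n)
        = (\<integral>\<^sup>+h. (\<Sum>i\<in>P \<inter> U. ennreal (weight \<rho> i h)) \<partial>random_hash n)"
    proof (rule nn_integral_cong_AE)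
      show "AE h in random_hash n. ennreal (estimate P h (\<rho> h, {x \<in> h ` U. x < \<rho> h}))
          = (\<Sum>i\<in>P \<inter> U. ennreal (weight \<rho> i h))"
        using AE_estimate_eq_sum_weight[OF U P, of \<rho>] AE_space
        by eventually_elim (auto intro!: sum_ennreal[symmetric] nonneg)
    qed
    also have "\<dots> = (\<Sum>i\<in>P \<inter> U. \<integral>\<^sup>+h. ennreal (weight \<rho> i h) \<partial>random_hash n)"
      using U by (intro nn_integral_sum) (auto intro!: measurable_compose[OF measurable_weight[OF \<rho>]])
    also have "\<dots> = (\<Sum>i\<in>P \<inter> U. 1)"
      using U by (intro sum.cong refl nn_integral_weight[OF \<rho>]) auto
    finally show ?thesis by (simp add: ennreal_of_nat_eq_real_of_nat)
  qed
  have square: "(\<integral>\<^sup>+h. ennreal ((estimate P h (\<rho> h, {x \<in> h ` U. x < \<rho> h}))\<^sup>2) \<partial>random_hash n)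
      = (\<integral>\<^sup>+h. ennreal ((\<Sum>i\<in>P \<inter> U. weight \<rho> i h)\<^sup>2) \<partial>random_hash n)" for \<rho>
  proof (rule nn_integral_cong_AE)
    show "AE h in random_hash n. ennreal ((estimate P h (\<rho> h, {x \<in> h ` U. x < \<rho> h}))\<^sup>2)
        = ennreal ((\<Sum>i\<in>P \<inter> U. weight \<rho> i h)\<^sup>2)"
      using AE_estimate_eq_sum_weight[OF U P, of \<rho>] by eventually_elim simp
  qed
  show ?thesis
    by (rule evariance_mono[OF prob_space_random_hash meas[OF \<tau>] pos meas[OF \<sigma>] pos _ mean[OF \<tau>] mean[OF \<sigma>]])
      (use U in \<open>auto simp only: square intro!: nn_integral_sum_weight_square_mono[OF \<sigma> \<tau> _ le]\<close>)
qed

section \<open>Thresholds of streams and of their union\<close>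

lemma good_threshold_tcf:
  assumes T: "threshold_choosing n T" "one_goodness n T" and k: "k \<ge> 1" and A: "A \<in> streams_over n"
    and meas: "T k A \<in> borel_measurable (random_hash n)"
  shows "good_threshold n (T k A)"
  unfolding good_threshold_def
proof (intro conjI meas ballI)
  fix i h assume i: "i \<in> {1..n}" and h: "h \<in> hashes n"
  show "one_good_fun (\<lambda>x. T k A (h(i := x)))"
  proof (cases "i \<in> set A")
    case True
    with T(2) k A h show ?thesis by (auto simp: one_goodness_def)
  next
    case False
    have "T k A (h(i := x)) = T k A h" if "x \<in> {0<..<1}" for x
      using T(1) k A h hashes_fun_upd[OF h i that] False unfolding threshold_choosing_def
      by (metis fun_upd_other)
    then have "one_good_fun (\<lambda>x. T k A (h(i := x))) \<longleftrightarrow> one_good_fun (\<lambda>x. T k A h)"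
      by (rule one_good_fun_cong)
    moreover have "T k A h \<in> {0<..1}"
      using T(1) k A h unfolding threshold_choosing_def greaterThanAtMost_iff by blast
    ultimately show ?thesis
      by (simp add: one_good_fun_const)
  qed
qed

lemma good_threshold_Min:
  assumes "finite I" "I \<noteq> {}" "\<And>i. i \<in> I \<Longrightarrow> good_threshold n (\<tau> i)"
  shows "good_threshold n (\<lambda>h. Min ((\<lambda>i. \<tau> i h) ` I))"
  using assms unfolding good_threshold_def
  by (auto intro!: borel_measurable_Min one_good_fun_Min)

lemma samp_eq: "samp T k A h = (T k A h, {x \<in> h ` set A. x < T k A h})"
  by (simp add: samp_def Let_def)

text \<open>Cutting at the minimum subsumes the earlier cut of each sketch, so the union has the
  form of a sample of the concatenated stream with the minimum as threshold.\<close>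

lemma theta_union_samp:
  "theta_union ((\<lambda>A. samp T k A h) ` set As)
     = (Min ((\<lambda>A. T k A h) ` set As),
        {x \<in> h ` set (concat As). x < Min ((\<lambda>A. T k A h) ` set As)})"
proof -
  define \<theta> where "\<theta> = Min ((\<lambda>A. T k A h) ` set As)"
  have le: "\<theta> \<le> T k A h" if "A \<in> set As" for A
    using that by (simp add: \<theta>_def)
  have "{x \<in> (\<Union>A\<in>set As. {x \<in> h ` set A. x < T k A h}). x < \<theta>} = {x \<in> h ` set (concat As). x < \<theta>}"
    using le by (auto simp: image_iff intro: less_le_trans)
  then show ?thesis
    by (simp add: theta_union_def samp_eq image_image Let_def flip: \<theta>_def)
qed

lemma concat_in_streams_over: "set As \<subseteq> streams_over n \<Longrightarrow> concat As \<in> streams_over n"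
  unfolding streams_over_def by (induction As) auto

lemma monotonicity_concat:
  assumes "monotonicity n T" "k \<ge> 1" "set As \<subseteq> streams_over n" "A \<in> set As" "h \<in> hashes n"
  shows "T k (concat As) h \<le> T k A h"
proof -
  \<comment> \<open>Splitting the list at \<open>A\<close> presents the concatenation as
    \<open>A\<close> between two streams, as Monotonicity requires.\<close>
  obtain Bs Cs where As: "As = Bs @ A # Cs"
    using split_list[OF assms(4)] by blast
  have "concat Bs \<in> streams_over n" "concat Cs \<in> streams_over n" "A \<in> streams_over n"
    using assms(3) by (auto simp: As intro: concat_in_streams_over)
  with assms(1,2,5) show ?thesis
    by (simp add: As monotonicity_def)
qed

theorem theorem11:
  fixes n k :: nat and T :: tcf and P :: "nat set" and As :: "stream list"
  assumes "threshold_choosing n T"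
    and "\<And>A. A \<in> streams_over n \<Longrightarrow> T k A \<in> borel_measurable (random_hash n)"
    and "one_goodness n T"
    and "monotonicity n T"
    and "P \<subseteq> {1..n}"
    and "k \<ge> 1"
    and "As \<noteq> []"
    and "set As \<subseteq> streams_over n"
  shows "evariance (random_hash n)
           (\<lambda>h. estimate P h (theta_union ((\<lambda>A. samp T k A h) ` set As)))
         \<le> evariance (random_hash n)
           (\<lambda>h. estimate P h (samp T k (concat As) h))"
  unfolding theta_union_samp unfolding samp_eq
\<comment> \<open>Both sketches now differ only in the threshold and share the identifiers
  \<open>set (concat As)\<close>.\<close>
proof (rule evariance_estimate_mono)
  have good: "good_threshold n (T k A)" if "A \<in> streams_over n" for A
    using assms that by (intro good_threshold_tcf)
  have concat: "concat As \<in> streams_over n"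
    using assms(8) by (rule concat_in_streams_over)
  then show "good_threshold n (T k (concat As))"
    by (rule good)
  show "good_threshold n (\<lambda>h. Min ((\<lambda>A. T k A h) ` set As))"
    using assms(7,8) by (intro good_threshold_Min good) auto
  show "set (concat As) \<subseteq> {1..n}"
    using concat by (auto simp: streams_over_def)
  show "T k (concat As) h \<le> Min ((\<lambda>A. T k A h) ` set As)" if "h \<in> hashes n" for h
    using assms(4,6,7,8) that by (auto intro: monotonicity_concat)
qed (fact assms(5))

end
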